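(* Let $c\ge0$, $\tau>0$, $t_0\in\mathbb{R}$, and let $\varphi:[-\tau,0]\to\mathbb{R}$ be continuous with $\varphi(0)=0$ and $\varphi(t)<0$ for all $t\in[-\tau,0)$. Let $h$ be a solution of the initial value problem $$\begin{cases} h'(t)=-\operatorname{sign}(h(t-\tau))+c\cos(2\pi t), & t>t_0,\\ h(t)=\varphi(t-t_0), & t\in[t_0-\tau,t_0].\end{cases}$$ Then the unique solution is, for $t\ge t_0$, $$h(t)=p(t)+\frac{c}{2\pi}\bigl(\sin(2\pi t)-\sin(2\pi t_0)\bigr),$$ where $p(t)$ is a continuous piecewise linear function. Assume furthermore that either $1+c\cos(2\pi t_0)>0$, or $1+c\cos(2\pi t_0)=0$ and $\sin(2\pi t_0)<0$. Let $z_1<z_2<\cdots$ be the nondegenerate zeros of $h$ in $(t_0,\infty)$, listed in increasing order. Then $$p(t)=\begin{cases} t-t_0, & t\in[t_0,t_0+\tau],\\ 2\tau-t+t_0, & t\in[t_0+\tau,z_1+\tau],\\ -2z_1+t+t_0, & t\in[z_1+\tau,z_2+\tau],\\ a_l\tau+2\sum_{m=1}^{l-1}(-1)^m z_m+(-1)^l t+t_0, & t\in[z_{l-1}+\tau,z_l+\tau]\ \text{for } l>2,\end{cases}$$ where $a_l=2$ when $l$ is odd and $a_l=0$ when $l$ is even.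
   Context: Here $\operatorname{sign}(0)=0$ and $\operatorname{sign}(x)=x/|x|$ for $x\ne0$. A solution of the initial value problem is a function that is continuous (and locally absolutely continuous) for $t\ge t_0$, satisfies the initial condition on $[t_0-\tau,t_0]$, and is differentiable and satisfies the differential equation for almost all $t>t_0$. A nondegenerate zero of $h$ is a point $z$ with $h(z)=0$ for which there is $\delta>0$ with $h(z_-)h(z_+)<0$ for all $z_-\in(z-\delta,z)$ and $z_+\in(z,z+\delta)$. *)

theory Defs
  imports "HOL-Analysis.Analysis"
begin

text \<open>Absolute continuity of a function on an interval, in the classical epsilon-delta sense
  (the library constant \<^const>\<open>absolutely_continuous\<close> is about measures).  A pair
  \<open>(x, y)\<close> in \<open>D\<close> stands for the open interval from \<open>x\<close> to \<open>y\<close>.\<close>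

definition abs_continuous_on_interval :: "real \<Rightarrow> real \<Rightarrow> (real \<Rightarrow> real) \<Rightarrow> bool" where
  "abs_continuous_on_interval a b f \<longleftrightarrow>
    (\<forall>\<epsilon>>0. \<exists>\<delta>>0. \<forall>D :: (real \<times> real) set.
       finite D \<and> (\<forall>(x, y)\<in>D. a \<le> x \<and> x < y \<and> y \<le> b) \<and>
       disjoint_family_on (\<lambda>(x, y). {x<..<y}) D \<and>
       (\<Sum>(x, y)\<in>D. y - x) < \<delta>
       \<longrightarrow> (\<Sum>(x, y)\<in>D. \<bar>f y - f x\<bar>) < \<epsilon>)"

definition locally_abs_continuous_from :: "real \<Rightarrow> (real \<Rightarrow> real) \<Rightarrow> bool" where
  "locally_abs_continuous_from t0 f \<longleftrightarrow>
    (\<forall>a b. t0 \<le> a \<and> a \<le> b \<longrightarrow> abs_continuous_on_interval a b f)"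

text \<open>The solution is a function on \<open>[t0 - \<tau>, \<infinity>)\<close>; the values of \<open>h\<close> to the left of
  \<open>t0 - \<tau>\<close> are irrelevant.\<close>

definition is_solution ::
  "real \<Rightarrow> real \<Rightarrow> real \<Rightarrow> (real \<Rightarrow> real) \<Rightarrow> (real \<Rightarrow> real) \<Rightarrow> bool" where
  "is_solution c \<tau> t0 \<phi> h \<longleftrightarrow>
     continuous_on {t0..} h \<and>
     locally_abs_continuous_from t0 h \<and>
     (\<forall>t\<in>{t0 - \<tau>..t0}. h t = \<phi> (t - t0)) \<and>
     (AE t in lebesgue. t > t0 \<longrightarrow>
        (h has_real_derivative (- sgn (h (t - \<tau>)) + c * cos (2 * pi * t))) (at t))"

definition nondegenerate_zero :: "(real \<Rightarrow> real) \<Rightarrow> real \<Rightarrow> bool" where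
  "nondegenerate_zero h z \<longleftrightarrow>
     h z = 0 \<and> (\<exists>\<delta>>0. \<forall>x\<in>{z - \<delta><..<z}. \<forall>y\<in>{z<..<z + \<delta>}. h x * h y < 0)"

text \<open>The sequence is indexed from 1; the value \<open>z 0\<close> is irrelevant.\<close>

definition lists_nondegenerate_zeros :: "real \<Rightarrow> (real \<Rightarrow> real) \<Rightarrow> (nat \<Rightarrow> real) \<Rightarrow> bool" where
  "lists_nondegenerate_zeros t0 h z \<longleftrightarrow>
     strict_mono_on {1..} z \<and> z ` {1..} = {t. t > t0 \<and> nondegenerate_zero h t}"

text \<open>\<open>S\<close> is the set of breakpoints, finitely many in every bounded interval.\<close>

definition piecewise_linear_on :: "real set \<Rightarrow> (real \<Rightarrow> real) \<Rightarrow> bool" where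
  "piecewise_linear_on I p \<longleftrightarrow>
     (\<exists>S. (\<forall>a b. finite (S \<inter> {a..b})) \<and>
          (\<forall>a b. {a<..<b} \<subseteq> I - S \<longrightarrow> (\<exists>m q. \<forall>t\<in>{a<..<b}. p t = m * t + q)))"

end

theory Submission
  imports Defs
begin

text \<open>By the method of steps the problem is equivalent to the integral equation
  \<open>h t = p t + c / (2 * pi) * (sin (2 * pi * t) - sin (2 * pi * t0))\<close> with \<open>p\<close> the integral of
  \<open>- sgn (h (s - \<tau>))\<close> from \<open>t0\<close> to \<open>t\<close>; uniqueness holds because an absolutely continuous function
  with vanishing derivative almost everywhere is constant.  By Rolle's theorem the zeros of \<open>h\<close> are
  locally finite: away from the finitely many shifted zeros of the previous step, \<open>h\<close> has derivative
  \<open>c * cos (2 * pi * t) + 1\<close> or \<open>c * cos (2 * pi * t) - 1\<close>.  Hence \<open>h\<close> changes sign exactly at its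
  nondegenerate zeros, and \<open>p\<close> has slope \<open>1\<close> or \<open>-1\<close> between the delayed ones.  There are infinitely
  many of them, since otherwise \<open>p\<close> would eventually have constant slope, driving \<open>h\<close> to the sign
  opposite to the one that produced this slope.\<close>

section \<open>Absolute continuity\<close>

lemma abs_continuous_on_intervalE:
  assumes "abs_continuous_on_interval a b f" "e > 0"
  obtains d where "d > 0" "\<And>D. finite D \<Longrightarrow> (\<forall>(x, y)\<in>D. a \<le> x \<and> x < y \<and> y \<le> b) \<Longrightarrow>
       disjoint_family_on (\<lambda>(x, y). {x<..<y}) D \<Longrightarrow> (\<Sum>(x, y)\<in>D. y - x) < d \<Longrightarrow>
       (\<Sum>(x, y)\<in>D. \<bar>f y - f x\<bar>) < e"
proof -
  have "\<exists>\<delta>>0. \<forall>D. finite D \<and> (\<forall>(x, y)\<in>D. a \<le> x \<and> x < y \<and> y \<le> b) \<and>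
       disjoint_family_on (\<lambda>(x, y). {x<..<y}) D \<and> (\<Sum>(x, y)\<in>D. y - x) < \<delta> \<longrightarrow>
       (\<Sum>(x, y)\<in>D. \<bar>f y - f x\<bar>) < e"
    using assms(1)[unfolded abs_continuous_on_interval_def, rule_format, OF assms(2)] .
  then obtain d where "d > 0" and d: "\<forall>D. finite D \<and> (\<forall>(x, y)\<in>D. a \<le> x \<and> x < y \<and> y \<le> b) \<and>
       disjoint_family_on (\<lambda>(x, y). {x<..<y}) D \<and> (\<Sum>(x, y)\<in>D. y - x) < d \<longrightarrow>
       (\<Sum>(x, y)\<in>D. \<bar>f y - f x\<bar>) < e"
    by (elim exE conjE)
  show ?thesis by (rule that[OF \<open>d > 0\<close>]) (rule d[rule_format], intro conjI)
qed

lemma abs_continuous_on_interval_diff: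
  assumes "abs_continuous_on_interval a b f" "abs_continuous_on_interval a b g"
  shows "abs_continuous_on_interval a b (\<lambda>x. f x - g x)"
  unfolding abs_continuous_on_interval_def
proof (intro allI impI)
  fix e :: real assume "e > 0"
  then have "e / 2 > 0" by simp
  obtain d1 where d1: "d1 > 0" "\<And>D. finite D \<Longrightarrow> (\<forall>(x, y)\<in>D. a \<le> x \<and> x < y \<and> y \<le> b) \<Longrightarrow>
       disjoint_family_on (\<lambda>(x, y). {x<..<y}) D \<Longrightarrow> (\<Sum>(x, y)\<in>D. y - x) < d1 \<Longrightarrow>
       (\<Sum>(x, y)\<in>D. \<bar>f y - f x\<bar>) < e / 2"
    using abs_continuous_on_intervalE[OF assms(1) \<open>e / 2 > 0\<close>] by blast
  obtain d2 where d2: "d2 > 0" "\<And>D. finite D \<Longrightarrow> (\<forall>(x, y)\<in>D. a \<le> x \<and> x < y \<and> y \<le> b) \<Longrightarrow>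
       disjoint_family_on (\<lambda>(x, y). {x<..<y}) D \<Longrightarrow> (\<Sum>(x, y)\<in>D. y - x) < d2 \<Longrightarrow>
       (\<Sum>(x, y)\<in>D. \<bar>g y - g x\<bar>) < e / 2"
    using abs_continuous_on_intervalE[OF assms(2) \<open>e / 2 > 0\<close>] by blast
  show "\<exists>\<delta>>0. \<forall>D. finite D \<and> (\<forall>(x, y)\<in>D. a \<le> x \<and> x < y \<and> y \<le> b) \<and>
       disjoint_family_on (\<lambda>(x, y). {x<..<y}) D \<and> (\<Sum>(x, y)\<in>D. y - x) < \<delta> \<longrightarrow>
       (\<Sum>(x, y)\<in>D. \<bar>f y - g y - (f x - g x)\<bar>) < e"
  proof (intro exI[of _ "min d1 d2"] conjI allI impI)
    fix D :: "(real \<times> real) set"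
    assume D: "finite D \<and> (\<forall>(x, y)\<in>D. a \<le> x \<and> x < y \<and> y \<le> b) \<and>
       disjoint_family_on (\<lambda>(x, y). {x<..<y}) D \<and> (\<Sum>(x, y)\<in>D. y - x) < min d1 d2"
    have "(\<Sum>(x, y)\<in>D. \<bar>f y - g y - (f x - g x)\<bar>)
        \<le> (\<Sum>(x, y)\<in>D. \<bar>f y - f x\<bar> + \<bar>g y - g x\<bar>)"
      by (intro sum_mono) auto
    also have "\<dots> = (\<Sum>(x, y)\<in>D. \<bar>f y - f x\<bar>) + (\<Sum>(x, y)\<in>D. \<bar>g y - g x\<bar>)"
      by (simp add: case_prod_unfold sum.distrib)
    also have "\<dots> < e / 2 + e / 2"
      using D d1(2)[of D] d2(2)[of D] by (intro add_strict_mono) auto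
    finally show "(\<Sum>(x, y)\<in>D. \<bar>f y - g y - (f x - g x)\<bar>) < e" by simp
  qed (use d1 d2 in auto)
qed

lemma lipschitz_imp_abs_continuous_on_interval:
  assumes "L-lipschitz_on {a..b} f"
  shows "abs_continuous_on_interval a b f"
  unfolding abs_continuous_on_interval_def
proof (intro allI impI)
  fix e :: real assume "e > 0"
  have L: "L \<ge> 0" using assms by (simp add: lipschitz_on_def)
  show "\<exists>\<delta>>0. \<forall>D. finite D \<and> (\<forall>(x, y)\<in>D. a \<le> x \<and> x < y \<and> y \<le> b) \<and>
       disjoint_family_on (\<lambda>(x, y). {x<..<y}) D \<and> (\<Sum>(x, y)\<in>D. y - x) < \<delta> \<longrightarrow>
       (\<Sum>(x, y)\<in>D. \<bar>f y - f x\<bar>) < e"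
  \<comment> \<open>Dividing by \<open>L + 1\<close> instead of \<open>L\<close> covers
    \<open>L = 0\<close> and makes the final estimate strict.\<close>
  proof (intro exI[of _ "e / (L + 1)"] conjI allI impI)
    show "e / (L + 1) > 0" using L \<open>e > 0\<close> by simp
    fix D :: "(real \<times> real) set"
    assume D: "finite D \<and> (\<forall>(x, y)\<in>D. a \<le> x \<and> x < y \<and> y \<le> b) \<and>
       disjoint_family_on (\<lambda>(x, y). {x<..<y}) D \<and> (\<Sum>(x, y)\<in>D. y - x) < e / (L + 1)"
    have "(\<Sum>(x, y)\<in>D. \<bar>f y - f x\<bar>) \<le> (\<Sum>(x, y)\<in>D. L * (y - x))"
    proof (intro sum_mono, clarify)
      fix x y assume "(x, y) \<in> D"
      then have "a \<le> x" "x < y" "y \<le> b" using D by auto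
      then show "\<bar>f y - f x\<bar> \<le> L * (y - x)"
        using lipschitz_onD[OF assms, of y x] by (simp add: dist_real_def)
    qed
    also have "\<dots> = L * (\<Sum>(x, y)\<in>D. y - x)"
      by (simp add: case_prod_unfold sum_distrib_left)
    also have "\<dots> \<le> L * (e / (L + 1))"
      using D L by (intro mult_left_mono) auto
    also have "\<dots> < e"
      using L \<open>e > 0\<close> by (simp add: field_simps)
    finally show "(\<Sum>(x, y)\<in>D. \<bar>f y - f x\<bar>) < e" .
  qed
qed

text \<open>Cousin's lemma: intervals tagged outside the exceptional null set contribute little because
  the derivative vanishes there, those tagged inside it because they lie in a small open set.\<close>

lemma abs_continuous_zero_derivative_imp_eq:
  fixes f :: "real \<Rightarrow> real"
  assumes "a \<le> b" and ac: "abs_continuous_on_interval a b f"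
    and deriv: "AE x in lebesgue. a < x \<and> x < b \<longrightarrow> (f has_real_derivative 0) (at x)"
  shows "f b = f a"
proof -
  obtain N0 where N0: "N0 \<in> null_sets lebesgue"
    "{x. \<not> (a < x \<and> x < b \<longrightarrow> (f has_real_derivative 0) (at x))} \<subseteq> N0"
    using deriv by (auto simp: eventually_ae_filter)
  \<comment> \<open>The endpoints join the exceptional set because the derivative is known only on
    the open interval.\<close>
  define N where "N = N0 \<union> {a, b}"
  have negl: "negligible N" using N0(1) by (simp add: N_def negligible_iff_null_sets negligible_Un)
  have deriv': "(f has_real_derivative 0) (at x)" if "x \<in> {a..b}" "x \<notin> N" for x
    using that N0(2) by (force simp: N_def)
  have "\<bar>f b - f a\<bar> \<le> e * (b - a + 1)" if "e > 0" for e
  proof -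
    obtain d where d: "d > 0" "\<And>D. finite D \<Longrightarrow> (\<forall>(x, y)\<in>D. a \<le> x \<and> x < y \<and> y \<le> b) \<Longrightarrow>
       disjoint_family_on (\<lambda>(x, y). {x<..<y}) D \<Longrightarrow> (\<Sum>(x, y)\<in>D. y - x) < d \<Longrightarrow>
       (\<Sum>(x, y)\<in>D. \<bar>f y - f x\<bar>) < e"
      using abs_continuous_on_intervalE[OF ac \<open>e > 0\<close>] by blast
    \<comment> \<open>Outer regularity: disjoint intervals inside \<open>U\<close> have total length
      below the \<open>d\<close> of absolute continuity.\<close>
    obtain U where U: "open U" "N \<subseteq> U" "U \<in> lmeasurable" "measure lebesgue U < d"
    proof -
      obtain T where T: "open T" "N \<subseteq> T" "T - N \<in> lmeasurable" "emeasure lebesgue (T - N) < ennreal d"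
        using sets_lebesgue_outer_open[of N d] negl d(1) negligible_imp_sets by blast
      have 1: "T = (T - N) \<union> N" using T(2) by auto
      have "T \<in> lmeasurable" using T(3) negl negligible_imp_measurable by (subst 1) blast
      moreover have "measure lebesgue T = measure lebesgue (T - N)"
        using negl by (metis "1" measure_Un_null_set negligible_iff_null_sets T(3) fmeasurableD)
      moreover have "measure lebesgue (T - N) < d"
        using T(3,4) d(1) by (simp add: emeasure_eq_measure2 ennreal_less_iff)
      ultimately show ?thesis using that T by auto
    qed
    \<comment> \<open>The gauge: points of \<open>N\<close> stay inside \<open>U\<close>, the other
      points of \<open>{a..b}\<close> keep their difference quotients below \<open>e\<close>, and
      elsewhere any radius will do.\<close>
    have "\<exists>r>0. (x \<in> N \<longrightarrow> ball x r \<subseteq> U) \<and>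
           (x \<in> {a..b} - N \<longrightarrow> (\<forall>y\<in>ball x r. \<bar>f y - f x\<bar> \<le> e * \<bar>y - x\<bar>))" for x
    proof (cases "x \<in> {a..b} - N")
      case True
      then have "(f has_real_derivative 0) (at x)" using deriv' by blast
      moreover have "(*) (0 :: real) = (\<lambda>h. 0)" by auto
      ultimately have "(f has_derivative (\<lambda>h. 0)) (at x)"
        by (simp only: has_field_derivative_def)
      then obtain r where "r > 0" "\<And>y. norm (y - x) < r \<Longrightarrow> norm (f y - f x - 0) \<le> e * norm (y - x)"
        using \<open>e > 0\<close> unfolding has_derivative_at_alt by blast
      then show ?thesis using True by (intro exI[of _ r]) (auto simp: dist_real_def abs_minus_commute)
    next
      case False
      show ?thesis
      proof (cases "x \<in> N")
        case True
        then show ?thesis using U(1,2) unfolding open_contains_ball by auto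
      next
        case False
        then show ?thesis using \<open>x \<notin> {a..b} - N\<close> by (intro exI[of _ 1]) auto
      qed
    qed
    then obtain r where r: "\<And>x. r x > 0" "\<And>x. x \<in> N \<Longrightarrow> ball x (r x) \<subseteq> U"
      "\<And>x y. x \<in> {a..b} - N \<Longrightarrow> y \<in> ball x (r x) \<Longrightarrow> \<bar>f y - f x\<bar> \<le> e * \<bar>y - x\<bar>"
      by metis
    have "gauge (\<lambda>x. ball x (r x))" using r(1) by (simp add: gauge_def)
    then obtain p where p: "p tagged_division_of {a..b}" "(\<lambda>x. ball x (r x)) fine p"
      using fine_division_exists_real by blast
    have finp: "finite p" using p(1) by blast
    have K: "\<exists>u v. u \<le> v \<and> K = {u..v} \<and> a \<le> u \<and> v \<le> b \<and> u \<le> x \<and> x \<le> v \<and> {u..v} \<subseteq> ball x (r x)"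
      if "(x, K) \<in> p" for x K
    proof -
      obtain u v where "K = cbox u v" using p(1) \<open>(x, K) \<in> p\<close> by blast
      moreover have "x \<in> K" "K \<subseteq> {a..b}" using p(1) \<open>(x, K) \<in> p\<close> by blast+
      moreover have "K \<subseteq> ball x (r x)" using p(2) \<open>(x, K) \<in> p\<close> by (auto simp: fine_def)
      ultimately show ?thesis by (intro exI[of _ u] exI[of _ v]) auto
    qed
    \<comment> \<open>Intervals shrunk to a point are left out: absolute continuity speaks of pairs
      with \<open>x < y\<close>, and \<open>f\<close> has no increment on them.\<close>
    define p1 where "p1 = {(x, K) \<in> p. x \<in> N \<and> Inf K < Sup K}"
    have p1: "p1 \<subseteq> p" "finite p1" using finp by (auto simp: p1_def intro: finite_subset)
    define \<pi> :: "real \<times> real set \<Rightarrow> real \<times> real" where "\<pi> = (\<lambda>(x, K). (Inf K, Sup K))"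
    have disj: "{Inf K<..<Sup K} \<inter> {Inf K'<..<Sup K'} = {}"
      if "(x, K) \<in> p1" "(x', K') \<in> p1" "(x, K) \<noteq> (x', K')" for x K x' K'
    proof -
      have "interior K \<inter> interior K' = {}" using that p1 p(1) by (blast dest: tagged_division_ofD(5))
      then show ?thesis using K[of x K] K[of x' K'] that p1 by force
    qed
    \<comment> \<open>Two elements with the same image would give a nonempty open interval disjoint
      from itself.\<close>
    have inj: "inj_on \<pi> p1"
    proof (rule inj_onI, clarify)
      fix x K x' K' assume *: "(x, K) \<in> p1" "(x', K') \<in> p1" "\<pi> (x, K) = \<pi> (x', K')"
      then have "{Inf K<..<Sup K} \<noteq> {}" by (auto simp: p1_def)
      then show "x = x' \<and> K = K'" using disj[OF *(1,2)] *(3) by (auto simp: \<pi>_def)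
    qed
    have D1: "\<forall>(x, y)\<in>\<pi> ` p1. a \<le> x \<and> x < y \<and> y \<le> b"
    proof clarify
      fix u v x K assume *: "(x, K) \<in> p1" "(u, v) = \<pi> (x, K)"
      then show "a \<le> u \<and> u < v \<and> v \<le> b"
        using K[of x K] by (auto simp: p1_def \<pi>_def)
    qed
    have D2: "disjoint_family_on (\<lambda>(x, y). {x<..<y}) (\<pi> ` p1)"
      unfolding disjoint_family_on_def using disj by (fastforce simp: \<pi>_def)
    have D3: "(\<Sum>(x, y)\<in>\<pi> ` p1. y - x) < d"
    proof -
      have "(\<Sum>(x, y)\<in>\<pi> ` p1. y - x) = (\<Sum>q\<in>\<pi> ` p1. measure lebesgue (case q of (x, y) \<Rightarrow> {x<..<y}))"
        using D1 by (intro sum.cong) auto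
      also have "\<dots> = measure lebesgue (\<Union>q\<in>\<pi> ` p1. case q of (x, y) \<Rightarrow> {x<..<y})"
        using p1(2) D1 D2 by (intro measure_finite_Union[symmetric]) auto
      also have "\<dots> \<le> measure lebesgue U"
      proof (intro measure_mono_fmeasurable U)
        show "(\<Union>q\<in>\<pi> ` p1. case q of (x, y) \<Rightarrow> {x<..<y}) \<subseteq> U"
        proof
          fix s assume "s \<in> (\<Union>q\<in>\<pi> ` p1. case q of (x, y) \<Rightarrow> {x<..<y})"
          then obtain x K where *: "(x, K) \<in> p1" "s \<in> {Inf K<..<Sup K}" by (auto simp: \<pi>_def)
          then have "x \<in> N" by (auto simp: p1_def)
          then show "s \<in> U" using * K[of x K] r(2)[of x] p1(1) by force
        qed
        show "(\<Union>q\<in>\<pi> ` p1. case q of (x, y) \<Rightarrow> {x<..<y}) \<in> sets lebesgue"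
          using p1(2) by (intro sets.finite_UN) auto
      qed
      finally show ?thesis using U(4) by simp
    qed
    have "(\<Sum>(x, y)\<in>\<pi> ` p1. \<bar>f y - f x\<bar>) = (\<Sum>(x, K)\<in>p1. \<bar>f (Sup K) - f (Inf K)\<bar>)"
      by (subst sum.reindex[OF inj]) (simp add: \<pi>_def case_prod_unfold)
    then have D: "(\<Sum>(x, K)\<in>p1. \<bar>f (Sup K) - f (Inf K)\<bar>) < e"
      using d(2)[OF _ D1 D2 D3] p1(2) by simp
    \<comment> \<open>The tag lies between the endpoints, so the estimates from it to either end add
      up to \<open>e\<close> times the length.\<close>
    have off: "\<bar>f (Sup K) - f (Inf K)\<bar> \<le> e * (Sup K - Inf K)" if "(x, K) \<in> p - p1" for x K
    proof -
      have "(x, K) \<in> p" using that by simp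
      from K[OF this] obtain u v where uv: "u \<le> v" "K = {u..v}" "a \<le> u" "v \<le> b" "u \<le> x"
        "x \<le> v" "{u..v} \<subseteq> ball x (r x)"
        by (elim exE conjE) (rule that)
      show ?thesis
      proof (cases "x \<in> N")
        case True
        then have "u = v" using that uv by (auto simp: p1_def)
        then show ?thesis using uv by simp
      next
        case False
        then have "x \<in> {a..b} - N" using uv by auto
        moreover have "u \<in> ball x (r x)" "v \<in> ball x (r x)"
          using uv(1,7) by (simp_all only: subset_iff atLeastAtMost_iff order.refl simp_thms)
        ultimately have "\<bar>f u - f x\<bar> \<le> e * \<bar>u - x\<bar>" "\<bar>f v - f x\<bar> \<le> e * \<bar>v - x\<bar>"
          using r(3) by blast+
        moreover have "\<bar>u - x\<bar> = x - u" "\<bar>v - x\<bar> = v - x" using uv by simp_all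
        ultimately have "\<bar>f v - f u\<bar> \<le> e * (x - u) + e * (v - x)" by (simp only: abs_le_iff) linarith
        then show ?thesis using uv by (simp add: algebra_simps)
      qed
    qed
    have "\<bar>f b - f a\<bar> = \<bar>\<Sum>(x, K)\<in>p. f (Sup K) - f (Inf K)\<bar>"
      using additive_tagged_division_1[OF \<open>a \<le> b\<close> p(1), of f] by simp
    also have "\<dots> \<le> (\<Sum>(x, K)\<in>p. \<bar>f (Sup K) - f (Inf K)\<bar>)"
      unfolding case_prod_unfold by (rule sum_abs)
    also have "\<dots> = (\<Sum>(x, K)\<in>p - p1. \<bar>f (Sup K) - f (Inf K)\<bar>) + (\<Sum>(x, K)\<in>p1. \<bar>f (Sup K) - f (Inf K)\<bar>)"
      using finp p1(1) by (simp add: sum.subset_diff)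
    also have "\<dots> \<le> (\<Sum>(x, K)\<in>p - p1. e * (Sup K - Inf K)) + e"
      using D off by (intro add_mono sum_mono) auto
    also have "(\<Sum>(x, K)\<in>p - p1. e * (Sup K - Inf K)) \<le> (\<Sum>(x, K)\<in>p. e * (Sup K - Inf K))"
    proof (rule sum_mono2[OF finp])
      show "0 \<le> (case q of (x, K) \<Rightarrow> e * (Sup K - Inf K))" if "q \<in> p - (p - p1)" for q
        using that \<open>e > 0\<close> by (auto simp: p1_def)
    qed auto
    also have "(\<Sum>(x, K)\<in>p. e * (Sup K - Inf K)) = e * (b - a)"
      using additive_tagged_division_1[OF \<open>a \<le> b\<close> p(1), of "\<lambda>x. x"]
      by (simp add: case_prod_unfold flip: sum_distrib_left)
    finally show ?thesis by (simp add: algebra_simps)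
  qed
  note bound = this
  have "\<bar>f b - f a\<bar> \<le> e" if "e > 0" for e
    using bound[of "e / (b - a + 1)"] that \<open>a \<le> b\<close> by simp
  then have "\<bar>f b - f a\<bar> \<le> 0" by (rule field_le_epsilon[of _ 0, simplified])
  then show ?thesis by simp
qed

section \<open>Isolated zeros and sign changes\<close>

text \<open>Rolle puts a point of \<open>E\<close> or a zero of \<open>f'\<close> strictly between
  any two zeros of \<open>f\<close>. A zero is therefore determined by the set of such points to its
  left, and a finite set has finitely many subsets.\<close>

lemma finite_zeros_if_finite_zeros_deriv:
  fixes f f' :: "real \<Rightarrow> real"
  assumes cont: "continuous_on {a..b} f" and "finite E"
    and deriv: "\<And>x. a < x \<Longrightarrow> x < b \<Longrightarrow> x \<notin> E \<Longrightarrow> (f has_real_derivative f' x) (at x)"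
    and fin: "finite {x \<in> {a..b}. f' x = 0}"
  shows "finite {x \<in> {a..b}. f x = 0}"
proof -
  define W where "W = E \<union> {x \<in> {a..b}. f' x = 0}"
  have sep: "\<exists>w\<in>W. x < w \<and> w < y" if "x \<in> {a..b}" "y \<in> {a..b}" "f x = 0" "f y = 0" "x < y" for x y
  proof (rule ccontr)
    assume no: "\<not> (\<exists>w\<in>W. x < w \<and> w < y)"
    have der: "(f has_real_derivative f' s) (at s)" if "x < s" "s < y" for s
      using that no \<open>x \<in> {a..b}\<close> \<open>y \<in> {a..b}\<close> by (intro deriv) (auto simp: W_def)
    have "continuous_on {x..y} f" using that by (intro continuous_on_subset[OF cont]) auto
    then have "\<exists>s. x < s \<and> s < y \<and> (f has_real_derivative 0) (at s)"
      using that der by (intro Rolle) (auto simp: real_differentiable_def)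
    then obtain s where s: "x < s" "s < y" "(f has_real_derivative 0) (at s)" by blast
    then have "f' s = 0" using der DERIV_unique by blast
    then show False using s no that by (auto simp: W_def)
  qed
  have "inj_on (\<lambda>x. {w \<in> W. w < x}) {x \<in> {a..b}. f x = 0}"
  proof (rule linorder_inj_onI')
    fix x y assume "x \<in> {x \<in> {a..b}. f x = 0}" "y \<in> {x \<in> {a..b}. f x = 0}" "x < y"
    with sep[of x y] obtain w where "w \<in> W" "x < w" "w < y" by auto
    then have "w \<in> {w \<in> W. w < y} - {w \<in> W. w < x}" by auto
    then show "{w \<in> W. w < x} \<noteq> {w \<in> W. w < y}" by blast
  qed
  moreover have "finite (Pow W)" using fin \<open>finite E\<close> by (simp add: W_def)
  moreover have "(\<lambda>x. {w \<in> W. w < x}) ` {x \<in> {a..b}. f x = 0} \<subseteq> Pow W" by auto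
  ultimately show ?thesis by (meson inj_on_finite)
qed

text \<open>For \<open>c \<noteq> 0\<close> the derivative is a multiple of the sine, which vanishes
  only at half-integers; for \<open>c = 0\<close> the function is the nonzero constant
  \<open>\<sigma>\<close>. With \<open>\<sigma>\<close> equal to 1 or -1 this bounds the critical
  points of \<open>h\<close>.\<close>

lemma finite_zeros_add_cos:
  fixes a b c \<sigma> :: real
  assumes "\<sigma> \<noteq> 0"
  shows "finite {x \<in> {a..b}. \<sigma> + c * cos (2 * pi * x) = 0}"
proof (cases "c = 0")
  case False
  have "finite {x \<in> {a..b}. - (2 * pi * c * sin (2 * pi * x)) = 0}"
  proof (rule finite_subset)
    show "{x \<in> {a..b}. - (2 * pi * c * sin (2 * pi * x)) = 0} \<subseteq> (\<lambda>i. of_int i / 2) ` {\<lfloor>2 * a\<rfloor>..\<lceil>2 * b\<rceil>}"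
    proof clarify
      fix x assume x: "x \<in> {a..b}" "- (2 * pi * c * sin (2 * pi * x)) = 0"
      then obtain i :: int where "2 * pi * x = of_int i * pi"
        using False by (auto simp: sin_zero_iff_int2)
      then have i: "2 * x = of_int i" by simp
      then have "\<lfloor>2 * a\<rfloor> \<le> i" "i \<le> \<lceil>2 * b\<rceil>" using x(1) by (auto simp: floor_le_iff le_ceiling_iff)
      then show "x \<in> (\<lambda>i. of_int i / 2) ` {\<lfloor>2 * a\<rfloor>..\<lceil>2 * b\<rceil>}"
        using i by (intro image_eqI[of _ _ i]) auto
    qed
  qed simp
  then show ?thesis
    by (rule finite_zeros_if_finite_zeros_deriv[where E = "{}", rotated 3])
       (auto intro!: continuous_intros derivative_eq_intros)
qed (use assms in simp)

text \<open>Measurability and the bound 1 suffice, so integrability is available before anything is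
  known about the zeros of \<open>f\<close>.\<close>

lemma integrable_on_sgn:
  fixes f :: "real \<Rightarrow> real"
  assumes "continuous_on {a..b} f"
  shows "(\<lambda>x. sgn (f x)) integrable_on {a..b}"
proof (rule measurable_bounded_by_integrable_imp_integrable)
  show "(\<lambda>x. sgn (f x)) \<in> borel_measurable (lebesgue_on {a..b})"
    by (rule measurable_compose[OF continuous_imp_measurable_on_sets_lebesgue[OF assms]]) auto
  show "(\<lambda>x. 1 :: real) integrable_on {a..b}" by (intro integrable_continuous_real) auto
qed (auto simp: sgn_if)

lemma no_zero_imp_same_sign:
  fixes f :: "real \<Rightarrow> real"
  assumes "continuous_on {u..v} f" "u \<le> v" "\<And>s. s \<in> {u..v} \<Longrightarrow> f s \<noteq> 0"
  shows "0 < f u * f v"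
proof (rule ccontr)
  assume "\<not> 0 < f u * f v"
  then have "f u \<le> 0 \<and> 0 \<le> f v \<or> f v \<le> 0 \<and> 0 \<le> f u"
    by (auto simp: zero_less_mult_iff)
  then obtain s where "s \<in> {u..v}" "f s = 0"
    using IVT'[of f u 0 v] IVT2'[of f v 0 u] assms(1,2) by auto
  then show False using assms(3) by blast
qed

text \<open>The last point at which \<open>f\<close> has the sign of \<open>f x\<close> is such a zero: zeros being isolated, the
  sign is constant on either side of it.\<close>

lemma sign_change_imp_nondegenerate_zero:
  fixes f :: "real \<Rightarrow> real"
  assumes cont: "continuous_on {x..y} f" and fin: "finite {s \<in> {x..y}. f s = 0}"
    and "x < y" and sign: "f x * f y < 0"
  shows "\<exists>w\<in>{x<..<y}. nondegenerate_zero f w"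
proof -
  \<comment> \<open>Multiplication by \<open>f x\<close> normalises the orientation:
    \<open>g\<close> goes from positive at \<open>x\<close> to negative at \<open>y\<close>.\<close>
  define g where "g s = f x * f s" for s
  have fx: "f x \<noteq> 0" using sign by auto
  have gx: "g x > 0" and gy: "g y < 0"
    using sign fx by (auto simp: g_def zero_less_mult_iff)
  have contg: "continuous_on {x..y} g" unfolding g_def by (intro continuous_intros cont)
  have g0: "g s = 0 \<longleftrightarrow> f s = 0" for s using fx by (auto simp: g_def)
  define A where "A = {s \<in> {x..y}. g s > 0}"
  define w where "w = Sup A"
  have "x \<in> A" using gx \<open>x < y\<close> by (auto simp: A_def)
  have bdd: "bdd_above A" by (auto simp: A_def bdd_above_def)
  have wxy: "w \<in> {x..y}"
    unfolding w_def using \<open>x \<in> A\<close> bdd by (auto intro!: cSup_upper cSup_least simp: A_def)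
  have right: "g s \<le> 0" if "w < s" "s \<le> y" for s
    using cSup_upper[OF _ bdd, of s] that wxy by (force simp: A_def w_def)
  have near: "\<exists>s\<in>A. w - d < s \<and> s \<le> w" if "d > 0" for d
    using less_cSupD[of A "w - d"] \<open>x \<in> A\<close> that cSup_upper[OF _ bdd] by (auto simp: w_def)
  have lim: "\<exists>d>0. \<forall>s\<in>{x..y}. \<bar>s - w\<bar> < d \<longrightarrow> \<bar>g s - g w\<bar> < \<bar>g w\<bar>" if "g w \<noteq> 0"
    using contg wxy that unfolding continuous_on_iff dist_real_def by (meson zero_less_abs_iff)
  have "g w = 0"
  proof (rule ccontr)
    assume "g w \<noteq> 0"
    then obtain d where d: "d > 0" "\<And>s. s \<in> {x..y} \<Longrightarrow> \<bar>s - w\<bar> < d \<Longrightarrow> \<bar>g s - g w\<bar> < \<bar>g w\<bar>"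
      using lim by blast
    obtain s where s: "s \<in> A" "w - d < s" "s \<le> w" using near d(1) by blast
    then have "g w > 0" using d(2)[of s] by (auto simp: A_def)
    then have "w < y" using gy wxy by (metis atLeastAtMost_iff less_eq_real_def not_less_iff_gr_or_eq)
    \<comment> \<open>A positive \<open>g w\<close> would keep \<open>g\<close> positive a little to
      the right of \<open>w\<close>, beyond the supremum of \<open>A\<close>.\<close>
    define m where "m = min y (w + d / 2)"
    have "m \<in> {x..y}" "w < m" "\<bar>m - w\<bar> < d"
      using wxy \<open>w < y\<close> d(1) by (auto simp: m_def min_def)
    then show False using d(2)[of m] right[of m] \<open>g w > 0\<close> by auto
  qed
  then have w: "x < w" "w < y" using gx gy wxy by (auto simp: less_le)
  obtain d0 where d0: "d0 > 0" "\<And>s. s \<in> {s \<in> {x..y}. f s = 0} \<Longrightarrow> s \<noteq> w \<Longrightarrow> d0 \<le> dist w s"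
    using finite_set_avoid[OF fin] by blast
  define d where "d = min d0 (min (w - x) (y - w))"
  have "d > 0" using d0(1) w by (auto simp: d_def)
  have nz: "g s \<noteq> 0" if "\<bar>s - w\<bar> < d" "s \<noteq> w" for s
    using that d0(2)[of s] by (force simp: d_def g0 dist_real_def)
  \<comment> \<open>Some point of \<open>A\<close> lies this close to \<open>w\<close>, and with no
    zero between it and \<open>s\<close> its positive sign carries over.\<close>
  have pos: "g s > 0" if s: "s \<in> {w - d<..<w}" for s
  proof -
    obtain a where a: "a \<in> A" "w - d < a" "a \<le> w" using near \<open>d > 0\<close> by blast
    have "a \<noteq> w" using a(1) \<open>g w = 0\<close> by (auto simp: A_def)
    have "continuous_on {min a s..max a s} g"
      by (rule continuous_on_subset[OF contg]) (use s a \<open>a \<noteq> w\<close> w in \<open>auto simp: d_def\<close>)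
    moreover have "g r \<noteq> 0" if "r \<in> {min a s..max a s}" for r
      using that s a \<open>a \<noteq> w\<close> by (intro nz) (auto simp: min_def max_def split: if_splits)
    ultimately have "0 < g (min a s) * g (max a s)" by (intro no_zero_imp_same_sign) auto
    then have "0 < g a * g s" by (auto simp: min_def max_def mult.commute split: if_splits)
    then show ?thesis using a(1) by (auto simp: A_def zero_less_mult_iff)
  qed
  have neg: "g s < 0" if s: "s \<in> {w<..<w + d}" for s
    using right[of s] nz[of s] s by (fastforce simp: d_def)
  have "f r * f s < 0" if "r \<in> {w - d<..<w}" "s \<in> {w<..<w + d}" for r s
    using pos[OF that(1)] neg[OF that(2)] by (auto simp: g_def zero_less_mult_iff mult_less_0_iff)
  then have "nondegenerate_zero f w"
    unfolding nondegenerate_zero_def using \<open>g w = 0\<close> \<open>d > 0\<close> g0 by auto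
  then show ?thesis using w by auto
qed

text \<open>The listing is obtained by iterating the successor function of the discrete set \<open>A\<close>.\<close>

lemma unbounded_locally_finite_enumeration:
  fixes A :: "real set" and a :: real
  assumes lower: "\<And>x. x \<in> A \<Longrightarrow> a < x" and fin: "\<And>b. finite {x \<in> A. x \<le> b}"
    and unbounded: "\<And>x. a \<le> x \<Longrightarrow> \<exists>y\<in>A. x < y"
  obtains z :: "nat \<Rightarrow> real" where "strict_mono_on {1..} z" "z ` {1..} = A"
proof -
  \<comment> \<open>Any element \<open>b\<close> of \<open>A\<close> above \<open>x\<close> reduces
    the search for a least one to a finite set.\<close>
  have "\<exists>y\<in>A. x < y \<and> (\<forall>w\<in>A. x < w \<longrightarrow> y \<le> w)" if "a \<le> x" for x
  proof -
    obtain b where b: "b \<in> A" "x < b" using unbounded[of x] \<open>a \<le> x\<close> by blast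
    define B where "B = {w \<in> A. w \<le> b} \<inter> {x<..}"
    have B: "finite B" "b \<in> B" using fin[of b] b by (auto simp: B_def)
    have "Min B \<in> B" using B by (intro Min_in) auto
    moreover have "Min B \<le> w" if "w \<in> A" "x < w" for w
    proof (cases "w \<le> b")
      case True
      then show ?thesis using that B(1) by (intro Min_le) (auto simp: B_def)
    next
      case False
      then show ?thesis using Min_le[OF B] by simp
    qed
    ultimately show ?thesis by (auto simp: B_def)
  qed
  then obtain N where N: "\<And>x. a \<le> x \<Longrightarrow> N x \<in> A" "\<And>x. a \<le> x \<Longrightarrow> x < N x"
    "\<And>x w. a \<le> x \<Longrightarrow> w \<in> A \<Longrightarrow> x < w \<Longrightarrow> N x \<le> w" by metis
  \<comment> \<open>Index 0 holds \<open>a\<close>, which is not in \<open>A\<close>; the listing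
    proper starts at 1.\<close>
  define z where "z n = (N ^^ n) a" for n
  have z_Suc: "z (Suc n) = N (z n)" for n by (simp add: z_def)
  have z_ge: "a \<le> z n" for n
    by (induction n) (auto simp: z_def intro: order.trans less_imp_le N)
  have z_A: "z n \<in> A" if "n \<ge> 1" for n
    using that z_Suc[of "n - 1"] N(1)[OF z_ge] by simp
  have mono: "strict_mono z"
    using N(2)[OF z_ge] by (intro strict_monoI_Suc) (simp add: z_Suc)
  have "w \<in> z ` {1..}" if "w \<in> A" for w
  proof (rule ccontr)
    assume w: "w \<notin> z ` {1..}"
    \<comment> \<open>An element that is never reached stays above every \<open>z n\<close>, which
      puts infinitely many elements of \<open>A\<close> below it.\<close>
    have less: "z n < w" for n
    proof (induction n)
      case 0
      then show ?case using lower that by (simp add: z_def)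
    next
      case (Suc n)
      then have "z (Suc n) \<le> w" using N(3)[OF z_ge] that by (simp add: z_Suc)
      moreover have "z (Suc n) \<noteq> w" using w by (auto simp: image_iff)
      ultimately show ?case by simp
    qed
    have "z ` {1..} \<subseteq> {x \<in> A. x \<le> w}" using less z_A by (auto intro: less_imp_le)
    then have "finite (z ` {1..})" using fin finite_subset by blast
    moreover have "inj_on z {1..}" using mono by (meson inj_on_subset strict_mono_imp_inj_on subset_UNIV)
    ultimately show False using finite_imageD infinite_Ici by blast
  qed
  then have "z ` {1..} = A" using z_A by auto
  moreover have "strict_mono_on {1..} z" using mono by (simp add: strict_mono_def strict_mono_on_def)
  ultimately show ?thesis using that by blast
qed

section \<open>The integral equation\<close>

text \<open>The equation holds at every point, so properties of \<open>h\<close> can be derived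
  without almost-everywhere derivatives; \<open>is_solution\<close> and
  \<open>signum_delay_equation_solution\<close> link it to the initial value problem.\<close>

locale signum_delay_equation =
  fixes c \<tau> t0 :: real and \<phi> h :: "real \<Rightarrow> real"
  assumes c_nonneg: "c \<ge> 0" and \<tau>_pos: "\<tau> > 0"
    and history_cont: "continuous_on {-\<tau>..0} \<phi>"
    and history_0: "\<phi> 0 = 0" and history_neg: "\<And>t. -\<tau> \<le> t \<Longrightarrow> t < 0 \<Longrightarrow> \<phi> t < 0"
    and history: "\<And>t. t0 - \<tau> \<le> t \<Longrightarrow> t \<le> t0 \<Longrightarrow> h t = \<phi> (t - t0)"
    and integral_eq: "\<And>t. t0 \<le> t \<Longrightarrow> h t = integral {t0..t} (\<lambda>s. - sgn (h (s - \<tau>)))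
        + c / (2 * pi) * (sin (2 * pi * t) - sin (2 * pi * t0))"
begin

definition p :: "real \<Rightarrow> real" where "p t = integral {t0..t} (\<lambda>s. - sgn (h (s - \<tau>)))"

lemma h_eq: "t0 \<le> t \<Longrightarrow> h t = p t + c / (2 * pi) * (sin (2 * pi * t) - sin (2 * pi * t0))"
  by (simp add: p_def integral_eq)

lemma p_t0 [simp]: "p t0 = 0"
  by (simp add: p_def)

lemma h_neg: "t0 - \<tau> \<le> t \<Longrightarrow> t < t0 \<Longrightarrow> h t < 0"
  using history[of t] history_neg[of "t - t0"] by simp

text \<open>The method of steps as an induction rule: a property inherited by smaller bounds
  advances by one delay at a time, and multiples of \<open>\<tau>\<close> pass every bound.\<close>

lemma forward_induct:
  assumes mono: "\<And>a b. b \<le> a \<Longrightarrow> P a \<Longrightarrow> P b" and base: "P t0"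
    and step: "\<And>a. t0 \<le> a \<Longrightarrow> P a \<Longrightarrow> P (a + \<tau>)"
  shows "P (t :: real)"
proof -
  have P: "P (t0 + real n * \<tau>)" for n
  proof (induction n)
    case (Suc n)
    then show ?case using step[of "t0 + real n * \<tau>"] \<tau>_pos by (simp add: algebra_simps)
  qed (use base in simp)
  obtain n where "(t - t0) / \<tau> \<le> real n" using real_arch_simple by blast
  then have "t \<le> t0 + real n * \<tau>" using \<tau>_pos by (simp add: field_simps)
  then show ?thesis using P mono by blast
qed

lemma integrable_shifted_sgn:
  assumes "continuous_on {t0 - \<tau>..b} h" "t0 - \<tau> \<le> u" "v \<le> b"
  shows "(\<lambda>s. - sgn (h (s - \<tau>))) integrable_on {u + \<tau>..v + \<tau>}"
proof -
  have "continuous_on {u + \<tau>..v + \<tau>} (\<lambda>s. h (s - \<tau>))"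
    using assms(2,3) by (intro continuous_on_compose2[OF assms(1)]) (auto intro!: continuous_intros)
  then show ?thesis by (intro integrable_neg integrable_on_sgn)
qed

lemma continuous_on_h_Icc: "continuous_on {t0 - \<tau>..b} h"
proof (rule forward_induct[of "\<lambda>b. continuous_on {t0 - \<tau>..b} h"])
  show "continuous_on {t0 - \<tau>..b'} h" if "b' \<le> b" "continuous_on {t0 - \<tau>..b} h" for b b'
    using that by (auto intro: continuous_on_subset)
  have "continuous_on {t0 - \<tau>..t0} (\<lambda>t. \<phi> (t - t0))"
    by (intro continuous_on_compose2[OF history_cont]) (auto intro!: continuous_intros)
  then show base: "continuous_on {t0 - \<tau>..t0} h"
    by (rule continuous_on_eq) (simp add: history)
  fix b assume "t0 \<le> b" and IH: "continuous_on {t0 - \<tau>..b} h"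
  \<comment> \<open>Up to \<open>b + \<tau>\<close> the integrand looks back at \<open>h\<close>
    only as far as \<open>b\<close>.\<close>
  have "(\<lambda>s. - sgn (h (s - \<tau>))) integrable_on {t0..b + \<tau>}"
    using integrable_shifted_sgn[OF IH, of "t0 - \<tau>" b] by simp
  then have "continuous_on {t0..b + \<tau>} p"
    unfolding p_def by (rule indefinite_integral_continuous_1)
  then have "continuous_on {t0..b + \<tau>}
      (\<lambda>t. p t + c / (2 * pi) * (sin (2 * pi * t) - sin (2 * pi * t0)))"
    by (intro continuous_intros)
  then have "continuous_on {t0..b + \<tau>} h"
    by (rule continuous_on_eq) (simp add: h_eq)
  then have "continuous_on ({t0 - \<tau>..t0} \<union> {t0..b + \<tau>}) h"
    using base by (intro continuous_on_closed_Un) auto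
  moreover have "{t0 - \<tau>..t0} \<union> {t0..b + \<tau>} = {t0 - \<tau>..b + \<tau>}"
    using \<tau>_pos \<open>t0 \<le> b\<close> by auto
  ultimately show "continuous_on {t0 - \<tau>..b + \<tau>} h" by simp
qed


section \<open>Lipschitz bounds, derivatives and finiteness of zeros\<close>

lemma integrable_p: "t0 \<le> u \<Longrightarrow> (\<lambda>s. - sgn (h (s - \<tau>))) integrable_on {u..v}"
  using integrable_shifted_sgn[OF continuous_on_h_Icc, of "u - \<tau>" "v - \<tau>" "v - \<tau>"] by simp

lemma p_diff:
  assumes "t0 \<le> u" "u \<le> v"
  shows "p v - p u = integral {u..v} (\<lambda>s. - sgn (h (s - \<tau>)))"
  using Henstock_Kurzweil_Integration.integral_combine[OF assms integrable_p[OF order.refl]]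
  by (simp add: p_def)

lemma p_lipschitz: "1-lipschitz_on {t0..} p"
proof (rule lipschitz_onI)
  have *: "\<bar>p v - p u\<bar> \<le> v - u" if "t0 \<le> u" "u \<le> v" for u v
  proof -
    have "norm (integral {u..v} (\<lambda>s. - sgn (h (s - \<tau>)))) \<le> integral {u..v} (\<lambda>s. 1)"
    proof (rule integral_norm_bound_integral)
      show "(\<lambda>s. - sgn (h (s - \<tau>))) integrable_on {u..v}" using that by (intro integrable_p)
      show "(\<lambda>s. 1 :: real) integrable_on {u..v}" by (rule integrable_const_ivl)
    qed (simp add: sgn_if)
    then show ?thesis using that by (simp add: p_diff)
  qed
  show "dist (p x) (p y) \<le> 1 * dist x y" if "x \<in> {t0..}" "y \<in> {t0..}" for x y
    using *[of x y] *[of y x] that by (cases "x \<le> y") (auto simp: dist_real_def abs_minus_commute)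
qed simp

lemma continuous_on_p: "continuous_on {t0..} p"
  using p_lipschitz by (rule lipschitz_on_continuous_on)

text \<open>This bound serves both regularity clauses of \<open>is_solution\<close>, continuity and
  local absolute continuity.\<close>

lemma h_lipschitz: "(1 + c)-lipschitz_on {t0..} h"
proof -
  have "(1 + c)-lipschitz_on {t0..} (\<lambda>t. p t + c / (2 * pi) * (sin (2 * pi * t) - sin (2 * pi * t0)))"
  proof (rule lipschitz_on_add[OF p_lipschitz], rule lipschitz_onI)
    fix x y :: real
    have "norm ((\<lambda>t. c / (2 * pi) * (sin (2 * pi * t) - sin (2 * pi * t0))) x
        - (\<lambda>t. c / (2 * pi) * (sin (2 * pi * t) - sin (2 * pi * t0))) y) \<le> c * norm (x - y)"
    proof (rule field_differentiable_bound[of UNIV])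
      show "((\<lambda>t. c / (2 * pi) * (sin (2 * pi * t) - sin (2 * pi * t0)))
          has_real_derivative c * cos (2 * pi * t)) (at t within UNIV)" for t
        by (rule derivative_eq_intros refl | simp)+
      show "norm (c * cos (2 * pi * t)) \<le> c" for t
        using c_nonneg by (simp add: abs_mult mult_left_le)
    qed auto
    then show "dist (c / (2 * pi) * (sin (2 * pi * x) - sin (2 * pi * t0)))
        (c / (2 * pi) * (sin (2 * pi * y) - sin (2 * pi * t0))) \<le> c * dist x y"
      by (simp add: dist_norm)
  qed (use c_nonneg in simp)
  then show ?thesis by (rule lipschitz_on_transform) (simp add: h_eq)
qed

text \<open>Where the delayed value is nonzero the integrand is continuous, so the fundamental
  theorem of calculus applies; integrating up to \<open>t + 1\<close> keeps \<open>t\<close>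
  interior.\<close>

lemma p_has_derivative:
  assumes "t0 < t" "h (t - \<tau>) \<noteq> 0"
  shows "(p has_real_derivative - sgn (h (t - \<tau>))) (at t)"
proof -
  have "isCont h (t - \<tau>)"
    using continuous_on_interior[OF continuous_on_h_Icc[of "t"], of "t - \<tau>"] assms \<tau>_pos by simp
  then have "isCont (\<lambda>s. h (s - \<tau>)) t"
    using isCont_o2[of t "\<lambda>s. s - \<tau>" h] by simp
  then have "isCont (\<lambda>s. - sgn (h (s - \<tau>))) t"
    using assms by (intro continuous_intros) auto
  then have "(p has_vector_derivative - sgn (h (t - \<tau>))) (at t within ({t0..t + 1} - {}))"
    unfolding p_def using assms \<tau>_pos
    by (intro integral_has_vector_derivative_continuous_at integrable_p)
       (auto intro: continuous_at_imp_continuous_at_within)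
  then show ?thesis
    using assms at_within_Icc_at[of t0 t "t + 1"]
    by (simp add: has_real_derivative_iff_has_vector_derivative)
qed

lemma h_has_derivative:
  assumes "t0 < t" "h (t - \<tau>) \<noteq> 0"
  shows "(h has_real_derivative - sgn (h (t - \<tau>)) + c * cos (2 * pi * t)) (at t)"
proof (rule has_field_derivative_transform_within_open[where S = "{t0<..}"])
  show "((\<lambda>t. p t + c / (2 * pi) * (sin (2 * pi * t) - sin (2 * pi * t0)))
      has_real_derivative - sgn (h (t - \<tau>)) + c * cos (2 * pi * t)) (at t)"
    using p_has_derivative[OF assms] by (auto intro!: derivative_eq_intros)
qed (use assms in \<open>auto simp: h_eq\<close>)

lemma finite_zeros: "finite {t \<in> {t0 - \<tau>..b}. h t = 0}"
proof (rule forward_induct[of "\<lambda>b. finite {t \<in> {t0 - \<tau>..b}. h t = 0}"])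
  show "finite {t \<in> {t0 - \<tau>..b'}. h t = 0}" if "b' \<le> b" "finite {t \<in> {t0 - \<tau>..b}. h t = 0}" for b b'
    using that(1) by (intro finite_subset[OF _ that(2)]) auto
  show base: "finite {t \<in> {t0 - \<tau>..t0}. h t = 0}"
    by (rule finite_subset[of _ "{t0}"]) (use h_neg in force)+
  fix b assume "t0 \<le> b" and IH: "finite {t \<in> {t0 - \<tau>..b}. h t = 0}"
  \<comment> \<open>The delayed zeros, finite by induction, are the exceptional points; elsewhere
    the signum is 1 or -1 and the derivative has one of two explicit forms.\<close>
  define E where "E = (\<lambda>t. t + \<tau>) ` {t \<in> {t0 - \<tau>..b}. h t = 0}"
  have nz: "h (t - \<tau>) \<noteq> 0" if "t0 \<le> t" "t \<le> b + \<tau>" "t \<notin> E" for t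
    using that by (auto simp: E_def image_iff dest: bspec[of _ _ "t - \<tau>"])
  have "finite {t \<in> {t0..b + \<tau>}. h t = 0}"
  proof (rule finite_zeros_if_finite_zeros_deriv)
    show "continuous_on {t0..b + \<tau>} h"
      by (rule continuous_on_subset[OF continuous_on_h_Icc[of "b + \<tau>"]]) (use \<tau>_pos in auto)
    show "finite E" using IH by (simp add: E_def)
    show "(h has_real_derivative - sgn (h (t - \<tau>)) + c * cos (2 * pi * t)) (at t)"
      if "t0 < t" "t < b + \<tau>" "t \<notin> E" for t
      using that nz[of t] by (intro h_has_derivative) auto
    have "{t \<in> {t0..b + \<tau>}. - sgn (h (t - \<tau>)) + c * cos (2 * pi * t) = 0}
       \<subseteq> E \<union> {t \<in> {t0..b + \<tau>}. 1 + c * cos (2 * pi * t) = 0}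
           \<union> {t \<in> {t0..b + \<tau>}. -1 + c * cos (2 * pi * t) = 0}"
      using nz by (auto simp: sgn_if split: if_splits)
    then show "finite {t \<in> {t0..b + \<tau>}. - sgn (h (t - \<tau>)) + c * cos (2 * pi * t) = 0}"
      by (rule finite_subset) (use finite_zeros_add_cos[of 1] finite_zeros_add_cos[of "-1"] IH in
          \<open>simp add: E_def\<close>)
  qed
  then have "finite ({t \<in> {t0 - \<tau>..t0}. h t = 0} \<union> {t \<in> {t0..b + \<tau>}. h t = 0})"
    using base by simp
  then show "finite {t \<in> {t0 - \<tau>..b + \<tau>}. h t = 0}" by (rule rev_finite_subset) auto
qed

section \<open>The initial value problem and uniqueness\<close>

lemma is_solution: "is_solution c \<tau> t0 \<phi> h"
  unfolding is_solution_def
proof (intro conjI ballI)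
  show "continuous_on {t0..} h" using h_lipschitz by (rule lipschitz_on_continuous_on)
  show "locally_abs_continuous_from t0 h"
    unfolding locally_abs_continuous_from_def
    by (auto intro!: lipschitz_imp_abs_continuous_on_interval lipschitz_on_subset[OF h_lipschitz])
  show "h t = \<phi> (t - t0)" if "t \<in> {t0 - \<tau>..t0}" for t using that history by simp
  \<comment> \<open>All delayed zeros: a countable union of finite sets, hence a null set outside of
    which \<open>h\<close> is differentiable.\<close>
  define Z where "Z = (\<lambda>t. t + \<tau>) ` (\<Union>n :: nat. {t \<in> {t0 - \<tau>..real n}. h t = 0})"
  have "countable Z" unfolding Z_def
    by (rule countable_image, rule countable_UN) (rule countableI_type countable_finite[OF finite_zeros])+
  then have "Z \<in> null_sets lebesgue" by (intro null_sets_completionI countable_imp_null_set_lborel)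
  then show "AE t in lebesgue. t > t0 \<longrightarrow>
      (h has_real_derivative - sgn (h (t - \<tau>)) + c * cos (2 * pi * t)) (at t)"
  proof (rule AE_I', intro subsetI)
    fix t assume "t \<in> {t \<in> space lebesgue. \<not> (t > t0 \<longrightarrow>
      (h has_real_derivative - sgn (h (t - \<tau>)) + c * cos (2 * pi * t)) (at t))}"
    then have t: "t0 < t"
      "\<not> (h has_real_derivative - sgn (h (t - \<tau>)) + c * cos (2 * pi * t)) (at t)"
      by simp_all
    then have "h (t - \<tau>) = 0" using h_has_derivative by blast
    moreover obtain n where "t - \<tau> \<le> real n" using real_arch_simple by blast
    ultimately show "t \<in> Z" using t(1) unfolding Z_def
      by (intro image_eqI[of _ _ "t - \<tau>"]) auto
  qed
qed

text \<open>Agreement up to \<open>b\<close> makes the two right-hand sides equal up to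
  \<open>b + \<tau>\<close>. The difference is then absolutely continuous with derivative 0 almost
  everywhere, and it vanishes at \<open>t0\<close>.\<close>

lemma solution_eq:
  assumes "is_solution c \<tau> t0 \<phi> g" "t0 - \<tau> \<le> t"
  shows "g t = h t"
proof -
  have "\<forall>t\<in>{t0 - \<tau>..t}. g t = h t"
  proof (rule forward_induct[of "\<lambda>b. \<forall>t\<in>{t0 - \<tau>..b}. g t = h t"])
    show base: "\<forall>t\<in>{t0 - \<tau>..t0}. g t = h t"
      using assms(1) history by (simp add: is_solution_def)
    fix b assume "t0 \<le> b" and IH: "\<forall>t\<in>{t0 - \<tau>..b}. g t = h t"
    have "g t = h t" if t: "t0 \<le> t" "t \<le> b + \<tau>" for t
    proof -
      have "abs_continuous_on_interval t0 t g" "abs_continuous_on_interval t0 t h"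
        using assms(1) is_solution t by (auto simp: is_solution_def locally_abs_continuous_from_def)
      then have "abs_continuous_on_interval t0 t (\<lambda>s. g s - h s)"
        by (rule abs_continuous_on_interval_diff)
      moreover have "AE s in lebesgue. t0 < s \<and> s < t \<longrightarrow> ((\<lambda>s. g s - h s) has_real_derivative 0) (at s)"
      proof -
        have "AE s in lebesgue. s > t0 \<longrightarrow>
            (g has_real_derivative - sgn (g (s - \<tau>)) + c * cos (2 * pi * s)) (at s)"
          using assms(1) by (simp add: is_solution_def)
        moreover have "AE s in lebesgue. s > t0 \<longrightarrow>
            (h has_real_derivative - sgn (h (s - \<tau>)) + c * cos (2 * pi * s)) (at s)"
          using is_solution by (simp add: is_solution_def)
        ultimately show ?thesis
        proof eventually_elim
          case (elim s)
          show ?case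
          proof
            assume s: "t0 < s \<and> s < t"
            then have "g (s - \<tau>) = h (s - \<tau>)" using IH t by auto
            then show "((\<lambda>s. g s - h s) has_real_derivative 0) (at s)"
              using DERIV_diff[OF elim(1)[rule_format] elim(2)[rule_format], of] s by simp
          qed
        qed
      qed
      ultimately have "g t - h t = g t0 - h t0"
        using t(1) by (intro abs_continuous_zero_derivative_imp_eq)
      then show ?thesis using base \<tau>_pos by simp
    qed
    then show "\<forall>t\<in>{t0 - \<tau>..b + \<tau>}. g t = h t" using base by force
  qed auto
  then show ?thesis using assms(2) by simp
qed

section \<open>Nondegenerate zeros and the piecewise linear part\<close>

text \<open>Values of opposite sign would force a nondegenerate zero between them. The inequality is
  weak because zeros without a change of sign may remain.\<close>

lemma constant_sign_between_nondegenerate_zeros: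
  assumes "t0 - \<tau> \<le> u" and nz: "\<And>w. u < w \<Longrightarrow> w < v \<Longrightarrow> \<not> nondegenerate_zero h w"
  obtains \<epsilon> :: real where "\<epsilon> = 1 \<or> \<epsilon> = -1" "\<And>s. u < s \<Longrightarrow> s < v \<Longrightarrow> 0 \<le> \<epsilon> * h s"
proof -
  have no: False if "u < x" "x < y" "y < v" "h x * h y < 0" for x y
  proof -
    have "continuous_on {x..y} h"
      by (rule continuous_on_subset[OF continuous_on_h_Icc[of y]]) (use assms(1) that in auto)
    moreover have "finite {s \<in> {x..y}. h s = 0}"
      by (rule finite_subset[OF _ finite_zeros[of y]]) (use assms(1) that in auto)
    ultimately have "\<exists>w\<in>{x<..<y}. nondegenerate_zero h w"
      using that(2,4) by (rule sign_change_imp_nondegenerate_zero)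
    then show False using nz that(1,3) by auto
  qed
  show ?thesis
  proof (cases "\<exists>x. u < x \<and> x < v \<and> h x < 0")
    case True
    then obtain x where x: "u < x" "x < v" "h x < 0" by blast
    have "h s \<le> 0" if s: "u < s" "s < v" for s
    proof (rule ccontr)
      assume "\<not> h s \<le> 0"
      then have "h x * h s < 0" "x \<noteq> s" using x by (auto simp: mult_neg_pos)
      then show False
        using no[of x s] no[of s x] x s by (cases "x < s") (auto simp: mult.commute)
    qed
    then show ?thesis by (intro that[of "-1"]) auto
  next
    case False
    then have "0 \<le> h s" if "u < s" "s < v" for s using that not_le by blast
    then show ?thesis by (intro that[of 1]) auto
  qed
qed

text \<open>The sign of \<open>h\<close> on an interval becomes, one delay later, the slope of
  \<open>p\<close> with the opposite sign; the zeros of \<open>h\<close> in between are finite in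
  number and do not affect the integral.\<close>

lemma p_linear:
  assumes u: "t0 - \<tau> \<le> u" and \<epsilon>: "\<epsilon> = 1 \<or> \<epsilon> = -1"
    and sign: "\<And>s. u < s \<Longrightarrow> s < v \<Longrightarrow> 0 \<le> \<epsilon> * h s"
    and t: "u + \<tau> \<le> t" "t \<le> v + \<tau>"
  shows "p t = p (u + \<tau>) - \<epsilon> * (t - u - \<tau>)"
proof -
  \<comment> \<open>The endpoints are excluded too, as the sign is assumed only on the open
    interval.\<close>
  define Z where "Z = (\<lambda>s. s + \<tau>) ` {s \<in> {t0 - \<tau>..t}. h s = 0} \<union> {u + \<tau>, t}"
  have "finite Z" unfolding Z_def using finite_zeros[of t] by simp
  have "p t - p (u + \<tau>) = integral {u + \<tau>..t} (\<lambda>s. - sgn (h (s - \<tau>)))"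
    using u t by (intro p_diff) auto
  also have "\<dots> = integral {u + \<tau>..t} (\<lambda>s. - \<epsilon>)"
  proof (rule integral_spike[OF negligible_finite[OF \<open>finite Z\<close>]])
    fix s assume s: "s \<in> {u + \<tau>..t} - Z"
    have "h (s - \<tau>) \<noteq> 0"
    proof
      assume "h (s - \<tau>) = 0"
      then have "s \<in> Z" unfolding Z_def using s u \<tau>_pos
        by (intro UnI1 image_eqI[of _ _ "s - \<tau>"]) auto
      then show False using s by simp
    qed
    moreover have "0 \<le> \<epsilon> * h (s - \<tau>)"
      using s t by (intro sign) (auto simp: Z_def less_le)
    ultimately show "- \<epsilon> = - sgn (h (s - \<tau>))"
      using \<epsilon> by (auto simp: sgn_if)
  qed
  also have "\<dots> = - \<epsilon> * (t - u - \<tau>)" using t by (simp add: algebra_simps)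
  finally show ?thesis by (simp add: algebra_simps)
qed

text \<open>The negative history is the case \<open>\<epsilon> = -1\<close> of
  \<open>p_linear\<close> on the interval from \<open>t0 - \<tau>\<close> to
  \<open>t0\<close>.\<close>

lemma p_initial:
  assumes "t0 \<le> t" "t \<le> t0 + \<tau>"
  shows "p t = t - t0"
proof -
  have "p t = p (t0 - \<tau> + \<tau>) - (-1) * (t - (t0 - \<tau>) - \<tau>)"
    by (rule p_linear[where v = t0]) (use assms h_neg in \<open>auto intro: less_imp_le\<close>)
  then show ?thesis by simp
qed

lemma piecewise_linear_p: "piecewise_linear_on {t0..} p"
proof -
  \<comment> \<open>Delayed degenerate zeros count as breakpoints as well; the set is still locally
    finite.\<close>
  define S where "S = {t. t0 \<le> t \<and> h (t - \<tau>) = 0}"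
  have "\<exists>m q. \<forall>t\<in>{a<..<b}. p t = m * t + q" if ab: "{a<..<b} \<subseteq> {t0..} - S" for a b
  proof (cases "a < b")
    case True
    have a: "t0 \<le> a"
    proof (rule ccontr)
      assume "\<not> t0 \<le> a"
      then have "(a + min b t0) / 2 \<in> {a<..<b}" "(a + min b t0) / 2 < t0" using True by (auto simp: min_def)
      then show False using ab by fastforce
    qed
    have "\<not> nondegenerate_zero h w" if "a - \<tau> < w" "w < b - \<tau>" for w
    proof -
      have "w + \<tau> \<in> {t0..} - S" using ab that by (auto simp: subset_iff)
      then show ?thesis by (auto simp: S_def nondegenerate_zero_def)
    qed
    then obtain \<epsilon> :: real where \<epsilon>: "\<epsilon> = 1 \<or> \<epsilon> = -1"
      "\<And>s. a - \<tau> < s \<Longrightarrow> s < b - \<tau> \<Longrightarrow> 0 \<le> \<epsilon> * h s"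
      using constant_sign_between_nondegenerate_zeros[of "a - \<tau>" "b - \<tau>"] a by auto
    have "p t = p a - \<epsilon> * (t - a)" if "t \<in> {a<..<b}" for t
      using p_linear[of "a - \<tau>" \<epsilon> "b - \<tau>" t] \<epsilon> a that by simp
    then show ?thesis
      by (intro exI[of _ "- \<epsilon>"] exI[of _ "p a + \<epsilon> * a"]) (simp add: algebra_simps)
  qed auto
  moreover have "finite (S \<inter> {a..b})" for a b
  proof (rule finite_subset)
    show "S \<inter> {a..b} \<subseteq> (\<lambda>t. t + \<tau>) ` {t \<in> {t0 - \<tau>..b}. h t = 0}"
    proof
      fix t assume "t \<in> S \<inter> {a..b}"
      then show "t \<in> (\<lambda>t. t + \<tau>) ` {t \<in> {t0 - \<tau>..b}. h t = 0}"
        using \<tau>_pos by (intro image_eqI[of _ _ "t - \<tau>"]) (auto simp: S_def)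
    qed
    show "finite ((\<lambda>t. t + \<tau>) ` {t \<in> {t0 - \<tau>..b}. h t = 0})"
      using finite_zeros by (rule finite_imageI)
  qed
  ultimately show ?thesis unfolding piecewise_linear_on_def by blast
qed

lemma nondegenerate_zeros_unbounded:
  assumes "t0 \<le> x"
  shows "\<exists>w>x. nondegenerate_zero h w"
proof (rule ccontr)
  assume no: "\<not> (\<exists>w>x. nondegenerate_zero h w)"
  \<comment> \<open>From \<open>x + \<tau>\<close> on, \<open>\<epsilon> * p\<close> falls with
    slope -1. The waiting time absorbs its initial value, then the bound \<open>c / pi\<close> of
    the oscillating term, and leaves \<open>\<epsilon> * h t \<le> -1\<close>.\<close>
  define t where "t = x + \<tau> + \<bar>p (x + \<tau>)\<bar> + c / pi + 1"
  have t: "x + \<tau> < t" using c_nonneg by (simp add: t_def add_nonneg_pos)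
  obtain \<epsilon> :: real where \<epsilon>: "\<epsilon> = 1 \<or> \<epsilon> = -1" "\<And>s. x < s \<Longrightarrow> s < t + 1 \<Longrightarrow> 0 \<le> \<epsilon> * h s"
    using constant_sign_between_nondegenerate_zeros[of x "t + 1"] no assms \<tau>_pos by auto
  have "p t = p (x + \<tau>) - \<epsilon> * (t - x - \<tau>)"
    by (rule p_linear[where v = "t + 1"]) (use \<epsilon> assms \<tau>_pos t in auto)
  then have "\<epsilon> * p t = \<epsilon> * p (x + \<tau>) - (t - x - \<tau>)"
    using \<epsilon>(1) by (auto simp: algebra_simps)
  also have "\<epsilon> * p (x + \<tau>) \<le> \<bar>p (x + \<tau>)\<bar>" using \<epsilon>(1) by auto
  finally have 1: "\<epsilon> * p t \<le> - (c / pi) - 1" by (simp add: t_def)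
  have "\<bar>sin (2 * pi * t) - sin (2 * pi * t0)\<bar> \<le> 2"
    using abs_sin_le_one[of "2 * pi * t"] abs_sin_le_one[of "2 * pi * t0"] by linarith
  then have "\<epsilon> * (sin (2 * pi * t) - sin (2 * pi * t0)) \<le> 2" using \<epsilon>(1) by auto
  then have "c / (2 * pi) * (\<epsilon> * (sin (2 * pi * t) - sin (2 * pi * t0))) \<le> c / (2 * pi) * 2"
    using c_nonneg by (intro mult_left_mono) auto
  also have "\<dots> = c / pi" by simp
  finally have 2: "\<epsilon> * (c / (2 * pi) * (sin (2 * pi * t) - sin (2 * pi * t0))) \<le> c / pi"
    by (simp add: mult.left_commute)
  have "h t = p t + c / (2 * pi) * (sin (2 * pi * t) - sin (2 * pi * t0))"
    using assms \<tau>_pos t by (intro h_eq) simp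
  then have "\<epsilon> * h t \<le> -1" using 1 2 by (simp only: distrib_left)
  moreover have "0 \<le> \<epsilon> * h t" using \<epsilon>(2) t \<tau>_pos by simp
  ultimately show False by simp
qed

lemma lists_nondegenerate_zeros_exists: "\<exists>z. lists_nondegenerate_zeros t0 h z"
proof -
  have fin: "finite {x \<in> {t. t0 < t \<and> nondegenerate_zero h t}. x \<le> b}" for b
    by (rule finite_subset[OF _ finite_zeros[of b]])
       (use \<tau>_pos in \<open>auto simp: nondegenerate_zero_def\<close>)
  have "\<exists>y\<in>{t. t0 < t \<and> nondegenerate_zero h t}. x < y" if "t0 \<le> x" for x
    using nondegenerate_zeros_unbounded[OF that] that by force
  then obtain z :: "nat \<Rightarrow> real" where "strict_mono_on {1..} z"
      "z ` {1..} = {t. t0 < t \<and> nondegenerate_zero h t}"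
    using unbounded_locally_finite_enumeration[of "{t. t0 < t \<and> nondegenerate_zero h t}" t0] fin
    by blast
  then show ?thesis by (auto simp: lists_nondegenerate_zeros_def)
qed

section \<open>Alternating signs of \<open>h\<close> and the explicit formula for
  \<open>p\<close>\<close>

text \<open>During the first delay \<open>h\<close> coincides with \<open>f\<close>, whose slope at
  \<open>t0\<close> is \<open>1 + c * cos (2 * pi * t0)\<close>. If this vanishes, the second
  derivative \<open>- (2 * pi * c * sin (2 * pi * t0))\<close> is positive and makes the slope
  positive right after \<open>t0\<close>.\<close>

lemma initially_positive:
  assumes "1 + c * cos (2 * pi * t0) > 0 \<or> (1 + c * cos (2 * pi * t0) = 0 \<and> sin (2 * pi * t0) < 0)"
  shows "\<exists>d>0. \<forall>t. t0 < t \<longrightarrow> t < t0 + d \<longrightarrow> 0 < h t"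
proof -
  define f where "f t = t - t0 + c / (2 * pi) * (sin (2 * pi * t) - sin (2 * pi * t0))" for t
  have f': "(f has_real_derivative 1 + c * cos (2 * pi * t)) (at t)" for t
    unfolding f_def by (auto intro!: derivative_eq_intros)
  have "\<exists>d>0. \<forall>t. t0 < t \<longrightarrow> t < t0 + d \<longrightarrow> 0 < f t"
  proof (cases "1 + c * cos (2 * pi * t0) > 0")
    case True
    then obtain d where d: "d > 0" "\<And>h. h > 0 \<Longrightarrow> h < d \<Longrightarrow> f t0 < f (t0 + h)"
      using DERIV_pos_inc_right[OF f'] by blast
    have "0 < f t" if "t0 < t" "t < t0 + d" for t
      using d(2)[of "t - t0"] that by (simp add: f_def)
    then show ?thesis using d(1) by blast
  next
    case False
    then have *: "1 + c * cos (2 * pi * t0) = 0" "sin (2 * pi * t0) < 0" using assms by auto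
    then have "c > 0" using c_nonneg by (cases "c = 0") auto
    have "((\<lambda>t. 1 + c * cos (2 * pi * t)) has_real_derivative - (2 * pi * c * sin (2 * pi * t0))) (at t0)"
      by (auto intro!: derivative_eq_intros)
    moreover have "- (2 * pi * c * sin (2 * pi * t0)) > 0"
      using *(2) \<open>c > 0\<close> by (simp add: mult_pos_neg)
    ultimately obtain d where d: "d > 0" "\<And>h. h > 0 \<Longrightarrow> h < d \<Longrightarrow> 0 < 1 + c * cos (2 * pi * (t0 + h))"
      using DERIV_pos_inc_right *(1) by metis
    have "0 < f t" if "t0 < t" "t < t0 + d" for t
    proof -
      have "f t0 < f t"
      proof (rule DERIV_pos_imp_increasing_open[OF that(1)])
        show "\<exists>y. (f has_real_derivative y) (at s) \<and> 0 < y" if "t0 < s" "s < t" for s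
          using f'[of s] d(2)[of "s - t0"] that \<open>t < t0 + d\<close> by auto
        show "continuous_on {t0..t} f"
          using f' by (intro DERIV_continuous_on) (blast intro: has_field_derivative_at_within)
      qed
      then show ?thesis by (simp add: f_def)
    qed
    then show ?thesis using d(1) by blast
  qed
  then obtain d where d: "d > 0" "\<And>t. t0 < t \<Longrightarrow> t < t0 + d \<Longrightarrow> 0 < f t" by blast
  have "0 < h t" if "t0 < t" "t < t0 + min d \<tau>" for t
    using d(2)[of t] that h_eq[of t] p_initial[of t] by (simp add: f_def)
  then show ?thesis using d(1) \<tau>_pos by (intro exI[of _ "min d \<tau>"]) auto
qed

context
  fixes z :: "nat \<Rightarrow> real"
  assumes z: "lists_nondegenerate_zeros t0 h z"
    and start: "1 + c * cos (2 * pi * t0) > 0 \<or> (1 + c * cos (2 * pi * t0) = 0 \<and> sin (2 * pi * t0) < 0)"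
begin

text \<open>With \<open>t0\<close> as zeroth entry, one formula covers all the intervals listed in the theorem.\<close>

definition zz :: "nat \<Rightarrow> real" where "zz n = (if n = 0 then t0 else z n)"

lemma zz_Suc: "t0 < zz (Suc n)" "nondegenerate_zero h (zz (Suc n))"
proof -
  have "z (Suc n) \<in> z ` {1..}" by (rule imageI) simp
  also have "\<dots> = {t. t > t0 \<and> nondegenerate_zero h t}"
    using z by (simp only: lists_nondegenerate_zeros_def)
  finally show "t0 < zz (Suc n)" "nondegenerate_zero h (zz (Suc n))" by (simp_all add: zz_def)
qed

lemma zz_less: "zz n < zz (Suc n)"
  using zz_Suc(1)[of n] z
  by (cases n) (auto simp: zz_def lists_nondegenerate_zeros_def strict_mono_on_def)

lemma zz_ge: "t0 \<le> zz n"
  using zz_Suc(1)[of "n - 1"] by (cases n) (auto simp: zz_def)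

lemma no_zero_between_zz:
  assumes "zz n < w" "w < zz (Suc n)"
  shows "\<not> nondegenerate_zero h w"
proof
  assume "nondegenerate_zero h w"
  moreover have "t0 < w" using assms(1) zz_ge[of n] by simp
  ultimately have "w \<in> z ` {1..}" using z by (simp add: lists_nondegenerate_zeros_def)
  then obtain m where "m \<ge> 1" "w = z m" by auto
  then have m: "zz n < zz m" "zz m < zz (Suc n)" using assms by (auto simp: zz_def)
  have "strict_mono zz" by (intro strict_monoI_Suc zz_less)
  then show False using m by (simp add: strict_mono_less)
qed

text \<open>\<open>h\<close> starts out positive and changes sign at each listed zero and nowhere
  else.\<close>

lemma sign_between_zz:
  assumes "zz n < s" "s < zz (Suc n)"
  shows "0 \<le> (-1) ^ n * h s"
  using assms
proof (induction n arbitrary: s)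
  case 0
  obtain \<epsilon> :: real where \<epsilon>: "\<epsilon> = 1 \<or> \<epsilon> = -1" "\<And>s. zz 0 < s \<Longrightarrow> s < zz 1 \<Longrightarrow> 0 \<le> \<epsilon> * h s"
    using constant_sign_between_nondegenerate_zeros[of "zz 0" "zz 1"] no_zero_between_zz[of 0] \<tau>_pos
      zz_ge[of 0] by auto
  obtain d where d: "d > 0" "\<And>t. t0 < t \<Longrightarrow> t < t0 + d \<Longrightarrow> 0 < h t"
    using initially_positive[OF start] by blast
  \<comment> \<open>A single point with \<open>h\<close> strictly positive decides between the two
    values of \<open>\<epsilon>\<close>.\<close>
  obtain r where "t0 < r" "r < min (t0 + d) (zz 1)"
    using dense[of t0 "min (t0 + d) (zz 1)"] d(1) zz_Suc(1)[of 0] by auto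
  then have "\<epsilon> = 1" using \<epsilon>(1) \<epsilon>(2)[of r] d(2)[of r] by (auto simp: zz_def)
  then show ?case using \<epsilon>(2)[of s] 0 by simp
next
  case (Suc n)
  define w where "w = zz (Suc n)"
  have w: "zz n < w" "w < zz (Suc (Suc n))" using zz_less by (auto simp: w_def)
  obtain \<epsilon> :: real where \<epsilon>: "\<epsilon> = 1 \<or> \<epsilon> = -1"
      "\<And>s. w < s \<Longrightarrow> s < zz (Suc (Suc n)) \<Longrightarrow> 0 \<le> \<epsilon> * h s"
    using constant_sign_between_nondegenerate_zeros[of w "zz (Suc (Suc n))"]
      no_zero_between_zz[of "Suc n"] \<tau>_pos zz_ge[of "Suc n"] by (auto simp: w_def)
  obtain d where d: "d > 0" "\<And>x y. x \<in> {w - d<..<w} \<Longrightarrow> y \<in> {w<..<w + d} \<Longrightarrow> h x * h y < 0"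
    using zz_Suc(2)[of n] unfolding nondegenerate_zero_def w_def by blast
  obtain x where x: "max (w - d) (zz n) < x" "x < w"
    using dense[of "max (w - d) (zz n)" w] d(1) w by auto
  obtain y where y: "w < y" "y < min (w + d) (zz (Suc (Suc n)))"
    using dense[of w "min (w + d) (zz (Suc (Suc n)))"] d(1) w by auto
  \<comment> \<open>Strictness here makes both \<open>h x\<close> and \<open>h y\<close> nonzero, so
    the two weak inequalities below determine \<open>\<epsilon>\<close>.\<close>
  have "h x * h y < 0" using d(2) x y by auto
  moreover have "0 \<le> (-1) ^ n * h x" using Suc.IH[of x] x by (simp add: w_def)
  moreover have "0 \<le> \<epsilon> * h y" using \<epsilon>(2) y by auto
  ultimately have "\<epsilon> = (-1) ^ Suc n"
    using \<epsilon>(1) by (cases "even n") (auto simp: mult_less_0_iff)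
  then show ?case using \<epsilon>(2)[of s] Suc.prems by (simp add: w_def)
qed

text \<open>The slope is \<open>(-1) ^ Suc n\<close>. Continuity at
  \<open>zz (Suc n) + \<tau>\<close> changes the constant by
  \<open>2 * (-1) ^ Suc n * (zz (Suc n) + \<tau>)\<close>: the zero contributes the next summand,
  and the delay switches the coefficient of \<open>\<tau>\<close> between 2 and 0.\<close>

lemma p_between_zz:
  assumes "zz n + \<tau> \<le> t" "t \<le> zz (Suc n) + \<tau>"
  shows "p t = (if odd (Suc n) then 2 else 0) * \<tau> + 2 * (\<Sum>m = 1..n. (-1) ^ m * zz m)
    + (-1) ^ Suc n * t + t0"
  using assms
proof (induction n arbitrary: t)
  have linear: "p t = p (zz n + \<tau>) - (-1) ^ n * (t - zz n - \<tau>)"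
    if "zz n + \<tau> \<le> t" "t \<le> zz (Suc n) + \<tau>" for n t
    by (rule p_linear[where v = "zz (Suc n)"])
       (use that zz_ge[of n] \<tau>_pos sign_between_zz[of n] in \<open>auto simp: uminus_power_if\<close>)
  {
    case 0
    have "zz 0 = t0" by (simp add: zz_def)
    then show ?case using linear[of 0 t] 0 p_initial[of "t0 + \<tau>"] \<tau>_pos by simp
  next
    case (Suc n)
    have "p (zz (Suc n) + \<tau>) = (if odd (Suc n) then 2 else 0) * \<tau>
        + 2 * (\<Sum>m = 1..n. (-1) ^ m * zz m) + (-1) ^ Suc n * (zz (Suc n) + \<tau>) + t0"
      using zz_less[of n] by (intro Suc.IH) auto
    then show ?case using linear[of "Suc n" t] Suc.prems
      by (cases "even n") (simp_all add: algebra_simps)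
  }
qed

text \<open>These are the cases \<open>n = 0\<close>, \<open>n = 1\<close> and
  \<open>n = l - 1\<close> of \<open>p_between_zz\<close>; only the first involves the added entry
  \<open>zz 0 = t0\<close>.\<close>

lemma p_formula:
  "t \<in> {t0 + \<tau>..z 1 + \<tau>} \<Longrightarrow> p t = 2 * \<tau> - t + t0"
  "t \<in> {z 1 + \<tau>..z 2 + \<tau>} \<Longrightarrow> p t = - 2 * z 1 + t + t0"
  "l > 2 \<Longrightarrow> t \<in> {z (l - 1) + \<tau>..z l + \<tau>} \<Longrightarrow>
    p t = (if odd l then 2 else 0) * \<tau> + 2 * (\<Sum>m = 1..l - 1. (-1) ^ m * z m) + (-1) ^ l * t + t0"
proof -
  show "p t = 2 * \<tau> - t + t0" if "t \<in> {t0 + \<tau>..z 1 + \<tau>}"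
    using p_between_zz[of 0 t] that by (simp add: zz_def)
  show "p t = - 2 * z 1 + t + t0" if "t \<in> {z 1 + \<tau>..z 2 + \<tau>}"
    using p_between_zz[of 1 t] that by (simp add: zz_def numeral_2_eq_2)
  assume l: "l > 2" "t \<in> {z (l - 1) + \<tau>..z l + \<tau>}"
  have "(\<Sum>m = 1..l - 1. (-1) ^ m * zz m) = (\<Sum>m = 1..l - 1. (-1) ^ m * z m)"
    by (intro sum.cong) (auto simp: zz_def)
  moreover have "Suc (l - 1) = l" using l(1) by simp
  ultimately show "p t = (if odd l then 2 else 0) * \<tau> + 2 * (\<Sum>m = 1..l - 1. (-1) ^ m * z m)
      + (-1) ^ l * t + t0"
    using p_between_zz[of "l - 1" t] l by (simp only: zz_def) auto
qed

end

section \<open>From solutions to the integral equation, and existence\<close>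

text \<open>Uniqueness transfers the integral equation from \<open>h\<close> to any solution
  \<open>g\<close>, and with it everything proved in the locale.\<close>

lemma signum_delay_equation_solution:
  assumes "is_solution c \<tau> t0 \<phi> g"
  shows "signum_delay_equation c \<tau> t0 \<phi> g"
proof
  have eq: "g t = h t" if "t0 - \<tau> \<le> t" for t using solution_eq[OF assms that] .
  show "g t = \<phi> (t - t0)" if "t0 - \<tau> \<le> t" "t \<le> t0" for t using that by (simp add: eq history)
  show "g t = integral {t0..t} (\<lambda>s. - sgn (g (s - \<tau>)))
        + c / (2 * pi) * (sin (2 * pi * t) - sin (2 * pi * t0))" if "t0 \<le> t" for t
  proof -
    have "integral {t0..t} (\<lambda>s. - sgn (g (s - \<tau>))) = integral {t0..t} (\<lambda>s. - sgn (h (s - \<tau>)))"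
      by (intro integral_cong) (simp add: eq)
    then show ?thesis using that \<tau>_pos by (simp add: eq integral_eq)
  qed
qed (use c_nonneg \<tau>_pos history_cont history_0 history_neg in auto)

end

text \<open>Method of steps: the \<open>n\<close>-th Picard iterate is already exact up to time \<open>t0 + n * \<tau>\<close>.\<close>

lemma signum_delay_equation_exists:
  assumes "c \<ge> 0" "\<tau> > 0" "continuous_on {-\<tau>..0} \<phi>" "\<phi> 0 = 0"
    and "\<And>t. -\<tau> \<le> t \<Longrightarrow> t < 0 \<Longrightarrow> \<phi> t < 0"
  shows "\<exists>h. signum_delay_equation c \<tau> t0 \<phi> h"
proof -
  define F :: "(real \<Rightarrow> real) \<Rightarrow> real \<Rightarrow> real" where
    "F h t = (if t \<le> t0 then \<phi> (t - t0) else integral {t0..t} (\<lambda>s. - sgn (h (s - \<tau>)))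
        + c / (2 * pi) * (sin (2 * pi * t) - sin (2 * pi * t0)))" for h t
  \<comment> \<open>\<open>F\<close> reads its argument only one delay back, so each application
    extends agreement by \<open>\<tau>\<close>.\<close>
  have F_cong: "F f t = F g t" if "\<And>s. s \<le> t - \<tau> \<Longrightarrow> f s = g s" for f g t
    using that by (auto simp: F_def intro!: integral_cong)
  define u where "u n = (F ^^ n) (\<lambda>t. \<phi> (t - t0))" for n
  have u_Suc: "u (Suc n) = F (u n)" for n by (simp add: u_def)
  have step_eq: "u (Suc n) t = u n t" if "t \<le> t0 + real n * \<tau>" for n t
    using that
  proof (induction n arbitrary: t)
    case 0
    then show ?case by (simp add: u_def F_def)
  next
    case (Suc n)
    then have "F (u (Suc n)) t = F (u n) t" by (intro F_cong Suc.IH) (auto simp: algebra_simps)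
    then show ?case by (simp add: u_Suc)
  qed
  have mono: "u m t = u n t" if "n \<le> m" "t \<le> t0 + real n * \<tau>" for m n t
    using that(1)
  proof (induction m rule: dec_induct)
    case (step m)
    have "real n * \<tau> \<le> real m * \<tau>" using step(1) assms(2) by (intro mult_right_mono) auto
    then show ?case using \<open>u m t = u n t\<close> that(2) step.hyps by (simp add: step_eq)
  qed simp
  have "\<exists>n. t \<le> t0 + real n * \<tau>" for t
  proof -
    obtain n where "(t - t0) / \<tau> \<le> real n" using real_arch_simple by blast
    then show ?thesis using assms(2) by (intro exI[of _ n]) (simp add: field_simps)
  qed
  then obtain N where N: "\<And>t. t \<le> t0 + real (N t) * \<tau>" by metis
  define h where "h t = u (N t) t" for t
  have h_u: "h t = u n t" if "t \<le> t0 + real n * \<tau>" for n t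
    using mono[OF _ N[of t], of "max n (N t)"] mono[OF _ that, of "max n (N t)"] by (simp add: h_def)
  have "h t = F h t" for t
  proof -
    have le: "real (N t) * \<tau> \<le> real (Suc (N t)) * \<tau>" using assms(2) by (intro mult_right_mono) auto
    \<comment> \<open>Taking one iterate more than necessary exposes an application of
      \<open>F\<close>.\<close>
    have "h t = u (Suc (N t)) t" using N[of t] le by (intro h_u) linarith
    also have "\<dots> = F h t"
      unfolding u_Suc using N[of t] assms(2) by (intro F_cong h_u[symmetric]) linarith
    finally show ?thesis .
  qed
  note fixpoint = this
  have "signum_delay_equation c \<tau> t0 \<phi> h"
  proof
    show "h t = \<phi> (t - t0)" if "t0 - \<tau> \<le> t" "t \<le> t0" for t
      using fixpoint[of t] that by (simp add: F_def)
    show "h t = integral {t0..t} (\<lambda>s. - sgn (h (s - \<tau>)))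
        + c / (2 * pi) * (sin (2 * pi * t) - sin (2 * pi * t0))" if "t0 \<le> t" for t
      \<comment> \<open>\<open>F\<close> assigns \<open>t0\<close> to the history; there both sides
        are 0 because \<open>\<phi> 0 = 0\<close>.\<close>
      using fixpoint[of t] that assms(4) by (cases "t = t0") (auto simp: F_def)
  qed (use assms in auto)
  then show ?thesis by blast
qed

theorem theorem2p2:
  fixes c \<tau> t0 :: real and \<phi> :: "real \<Rightarrow> real"
  assumes "c \<ge> 0" and "\<tau> > 0"
    and "continuous_on {-\<tau>..0} \<phi>" and "\<phi> 0 = 0" and "\<forall>t\<in>{-\<tau>..<0}. \<phi> t < 0"
  shows "(\<exists>h. is_solution c \<tau> t0 \<phi> h) \<and>
    (\<forall>h. is_solution c \<tau> t0 \<phi> h \<longrightarrow>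
      (\<forall>g. is_solution c \<tau> t0 \<phi> g \<longrightarrow> (\<forall>t\<ge>t0 - \<tau>. g t = h t)) \<and>
      (\<exists>p. continuous_on {t0..} p \<and> piecewise_linear_on {t0..} p \<and>
        (\<forall>t\<ge>t0. h t = p t + c / (2 * pi) * (sin (2 * pi * t) - sin (2 * pi * t0))) \<and>
        (1 + c * cos (2 * pi * t0) > 0 \<or>
           (1 + c * cos (2 * pi * t0) = 0 \<and> sin (2 * pi * t0) < 0) \<longrightarrow>
          (\<exists>z. lists_nondegenerate_zeros t0 h z) \<and>
          (\<forall>z. lists_nondegenerate_zeros t0 h z \<longrightarrow>
            (\<forall>t\<in>{t0..t0 + \<tau>}. p t = t - t0) \<and>
            (\<forall>t\<in>{t0 + \<tau>..z 1 + \<tau>}. p t = 2 * \<tau> - t + t0) \<and>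
            (\<forall>t\<in>{z 1 + \<tau>..z 2 + \<tau>}. p t = - 2 * z 1 + t + t0) \<and>
            (\<forall>l>2. \<forall>t\<in>{z (l - 1) + \<tau>..z l + \<tau>}.
               p t = (if odd l then 2 else 0) * \<tau>
                     + 2 * (\<Sum>m = 1..l - 1. (-1) ^ m * z m) + (-1) ^ l * t + t0)))))"
proof -
  \<comment> \<open>One function satisfying the integral equation comes first: by comparison with
    it, an arbitrary solution \<open>h\<close> satisfies the equation as well.\<close>
  obtain h0 where "signum_delay_equation c \<tau> t0 \<phi> h0"
    using signum_delay_equation_exists[OF assms(1-4), of t0] assms(5) by auto
  then interpret h0: signum_delay_equation c \<tau> t0 \<phi> h0 .
  show ?thesis
  proof (intro conjI allI impI)
    show "\<exists>h. is_solution c \<tau> t0 \<phi> h" using h0.is_solution by blast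
  next
    fix h assume h: "is_solution c \<tau> t0 \<phi> h"
    interpret h: signum_delay_equation c \<tau> t0 \<phi> h
      using h by (rule h0.signum_delay_equation_solution)
    show "g t = h t" if "is_solution c \<tau> t0 \<phi> g" "t \<ge> t0 - \<tau>" for g t
      using that by (rule h.solution_eq)
    show "\<exists>p. continuous_on {t0..} p \<and> piecewise_linear_on {t0..} p \<and>
        (\<forall>t\<ge>t0. h t = p t + c / (2 * pi) * (sin (2 * pi * t) - sin (2 * pi * t0))) \<and>
        (1 + c * cos (2 * pi * t0) > 0 \<or>
           (1 + c * cos (2 * pi * t0) = 0 \<and> sin (2 * pi * t0) < 0) \<longrightarrow>
          (\<exists>z. lists_nondegenerate_zeros t0 h z) \<and>
          (\<forall>z. lists_nondegenerate_zeros t0 h z \<longrightarrow>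
            (\<forall>t\<in>{t0..t0 + \<tau>}. p t = t - t0) \<and>
            (\<forall>t\<in>{t0 + \<tau>..z 1 + \<tau>}. p t = 2 * \<tau> - t + t0) \<and>
            (\<forall>t\<in>{z 1 + \<tau>..z 2 + \<tau>}. p t = - 2 * z 1 + t + t0) \<and>
            (\<forall>l>2. \<forall>t\<in>{z (l - 1) + \<tau>..z l + \<tau>}.
               p t = (if odd l then 2 else 0) * \<tau>
                     + 2 * (\<Sum>m = 1..l - 1. (-1) ^ m * z m) + (-1) ^ l * t + t0)))"
    proof (intro exI[of _ h.p] conjI allI ballI impI)
      show "continuous_on {t0..} h.p" by (rule h.continuous_on_p)
      show "piecewise_linear_on {t0..} h.p" by (rule h.piecewise_linear_p)
      show "h t = h.p t + c / (2 * pi) * (sin (2 * pi * t) - sin (2 * pi * t0))" if "t \<ge> t0" for t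
        using that by (rule h.h_eq)
      show "\<exists>z. lists_nondegenerate_zeros t0 h z" by (rule h.lists_nondegenerate_zeros_exists)
      show "h.p t = t - t0" if "t \<in> {t0..t0 + \<tau>}" for t
        using that by (intro h.p_initial) auto
    qed (use h.p_formula in blast)+
  qed
qed

end
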